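(* Assume that $F=\frac1n\sum_{i=1}^nf_i$ is $\mu$-strongly convex and each $f_i\in C_L^1(\mathbb R^d)$. Consider SingleShuffle with initialization $\boldsymbol x_0$, run for a number of epochs $K$ satisfying $K\ge10\,\kappa^2\log(n^{1/2}K)$, with constant step size $\eta_i^k=\eta:=\frac{2\log(n^{1/2}K)}{\mu nK}$. Then the following bound holds for some $c=O(\kappa^4)$: $$\mathbb E\big[F(\boldsymbol x_0^{K+1})\big]-F^*\;\le\;\frac{2L\|\boldsymbol x_0-\boldsymbol x^*\|^2}{nK^2}+\frac{c\cdot\log^3(nK)}{nK^2}.$$
   Context: Setting: $n\ge2$ and $d\ge1$ are integers, $f_1,\dots,f_n:\mathbb R^d\to\mathbb R$ are differentiable (not necessarily convex), $F:=\frac1n\sum_{i=1}^n f_i$, $[a]:=\{1,\dots,a\}$, $\|\cdot\|$ is the Euclidean norm, $\log$ is the natural logarithm, $L,\mu>0$, $\kappa:=L/\mu$, $\boldsymbol x^*$ is the minimizer of $F$ and $F^*=F(\boldsymbol x^* )$. $C_L^1(\mathbb R^d)$ is the class of differentiable $L$-smooth functions on $\mathbb R^d$, i.e. differentiable functions with $L$-Lipschitz gradient. $F$ is $\mu$-strongly convex if $F(\boldsymbol y)\ge F(\boldsymbol x)+\langle\nabla F(\boldsymbol x),\boldsymbol y-\boldsymbol x\rangle+\frac\mu2\|\boldsymbol y-\boldsymbol x\|^2$ for all $\boldsymbol x,\boldsymbol y$. SingleShuffle: draw one permutation $\sigma$ of $[n]$ uniformly at random and use it in all epochs. Set $\boldsymbol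 x_0^1:=\boldsymbol x_0$; in each epoch $k=1,\dots,K$, for $i=1,\dots,n$ set $\boldsymbol x_i^k:=\boldsymbol x_{i-1}^k-\eta_i^k\nabla f_{\sigma(i)}(\boldsymbol x_{i-1}^k)$; then set $\boldsymbol x_0^{k+1}:=\boldsymbol x_n^k$. The expectation is over $\sigma$. Meaning of $c=O(\kappa^4)$: let $G:=\max_{i\in[n]}\|\nabla f_i(\boldsymbol x^* )\|$. The paper uses the convention $\kappa=\Theta(1/\mu)$, so $L$ and $G$ are treated as constants: $c\le C\kappa^4$ where $C$ depends only on $L$ and $G$ (not on $\mu,n,K,d$). *)

theory Defs
  imports "HOL-Probability.Probability"
begin

text \<open>
  The constant in the theorem must not depend on the dimension \<open>d\<close>, so \<open>d\<close> is quantified inside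
  the statement and cannot be a type index. All the spaces \<open>R^d\<close> are therefore realised inside one
  real inner product space, that of the finitely supported real sequences with the standard inner
  product: \<open>R^d\<close> is the subspace of the sequences that vanish from index \<open>d\<close> on.
\<close>

typedef finseq = "{x :: nat \<Rightarrow> real. finite {i. x i \<noteq> 0}}"
  morphisms coord Abs_finseq
  by (rule exI[of _ "\<lambda>_. 0"]) simp

setup_lifting type_definition_finseq

lemma finite_support_coord: "finite {i. coord x i \<noteq> 0}"
  using coord[of x] by simp

lemma finseq_eqI: "(\<And>i. coord x i = coord y i) \<Longrightarrow> x = y"
  by (metis coord_inject ext)

instantiation finseq :: real_vector
begin

lift_definition zero_finseq :: finseq is "\<lambda>_. 0"
  by simp

lift_definition plus_finseq :: "finseq \<Rightarrow> finseq \<Rightarrow> finseq" is "\<lambda>x y i. x i + y i"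
proof -
  fix x y :: "nat \<Rightarrow> real"
  assume "finite {i. x i \<noteq> 0}" "finite {i. y i \<noteq> 0}"
  then show "finite {i. x i + y i \<noteq> 0}"
    by (rule finite_subset[rotated, OF finite_UnI]) auto
qed

lift_definition uminus_finseq :: "finseq \<Rightarrow> finseq" is "\<lambda>x i. - x i"
  by simp

lift_definition minus_finseq :: "finseq \<Rightarrow> finseq \<Rightarrow> finseq" is "\<lambda>x y i. x i - y i"
proof -
  fix x y :: "nat \<Rightarrow> real"
  assume "finite {i. x i \<noteq> 0}" "finite {i. y i \<noteq> 0}"
  then show "finite {i. x i - y i \<noteq> 0}"
    by (rule finite_subset[rotated, OF finite_UnI]) auto
qed

lift_definition scaleR_finseq :: "real \<Rightarrow> finseq \<Rightarrow> finseq" is "\<lambda>c x i. c * x i"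
  by (rule finite_subset) auto

instance
  by standard (transfer; simp add: algebra_simps fun_eq_iff)+

end

lemmas coord_simps [simp] =
  zero_finseq.rep_eq plus_finseq.rep_eq uminus_finseq.rep_eq minus_finseq.rep_eq
  scaleR_finseq.rep_eq

instantiation finseq :: real_inner
begin

definition inner_finseq :: "finseq \<Rightarrow> finseq \<Rightarrow> real" where
  "inner_finseq x y = (\<Sum>i | coord x i \<noteq> 0. coord x i * coord y i)"

definition norm_finseq :: "finseq \<Rightarrow> real" where
  "norm_finseq x = sqrt (inner x x)"

definition dist_finseq :: "finseq \<Rightarrow> finseq \<Rightarrow> real" where
  "dist_finseq x y = norm (x - y)"

definition sgn_finseq :: "finseq \<Rightarrow> finseq" where
  "sgn_finseq x = x /\<^sub>R norm x"

definition uniformity_finseq :: "(finseq \<times> finseq) filter" where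
  "uniformity_finseq = (INF e\<in>{0<..}. principal {(x, y). dist x y < e})"

definition open_finseq :: "finseq set \<Rightarrow> bool" where
  "open_finseq U \<longleftrightarrow> (\<forall>x\<in>U. \<forall>\<^sub>F (x', y) in uniformity. x' = x \<longrightarrow> y \<in> U)"

lemma inner_finseq_superset:
  assumes "finite A" "{i. coord x i \<noteq> 0} \<subseteq> A"
  shows "inner x y = (\<Sum>i\<in>A. coord x i * coord y i)"
  unfolding inner_finseq_def using assms by (intro sum.mono_neutral_left) auto

instance
proof
  fix x y z :: finseq and r :: real
  let ?A = "{i. coord x i \<noteq> 0} \<union> {i. coord y i \<noteq> 0}"
  have A: "finite ?A"
    by (simp add: finite_support_coord)
  show "inner x y = inner y x"
    using inner_finseq_superset[OF A, of x y] inner_finseq_superset[OF A, of y x]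
    by (simp add: mult.commute)
  have "inner (x + y) z = (\<Sum>i\<in>?A. coord (x + y) i * coord z i)"
    by (rule inner_finseq_superset[OF A]) auto
  also have "\<dots> = inner x z + inner y z"
    using inner_finseq_superset[OF A, of x z] inner_finseq_superset[OF A, of y z]
    by (simp add: distrib_right sum.distrib)
  finally show "inner (x + y) z = inner x z + inner y z" .
  have "inner (r *\<^sub>R x) z = (\<Sum>i\<in>?A. coord (r *\<^sub>R x) i * coord z i)"
    by (rule inner_finseq_superset[OF A]) auto
  then show "inner (r *\<^sub>R x) z = r * inner x z"
    using inner_finseq_superset[OF A, of x z] by (simp add: sum_distrib_left mult.assoc)
  show "0 \<le> inner x x"
    by (simp add: inner_finseq_def sum_nonneg)
  show "inner x x = 0 \<longleftrightarrow> x = 0"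
  proof
    assume "inner x x = 0"
    then have "\<forall>i\<in>{i. coord x i \<noteq> 0}. coord x i * coord x i = 0"
      unfolding inner_finseq_def
      by (subst (asm) sum_nonneg_eq_0_iff) (simp_all add: finite_support_coord)
    then show "x = 0"
      by (intro finseq_eqI) auto
  qed (simp add: inner_finseq_def)
qed (simp_all add: norm_finseq_def dist_finseq_def sgn_finseq_def uniformity_finseq_def
    open_finseq_def)

end

definition Rd :: "nat \<Rightarrow> finseq set" where
  "Rd d = {x. \<forall>i\<ge>d. coord x i = 0}"

lemma inner_Rd: "x \<in> Rd d \<Longrightarrow> x \<bullet> y = (\<Sum>i<d. coord x i * coord y i)"
  by (rule inner_finseq_superset) (auto simp: Rd_def not_le[symmetric])

lemma norm_Rd: "x \<in> Rd d \<Longrightarrow> norm x = sqrt (\<Sum>i<d. (coord x i)\<^sup>2)"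
  by (simp add: norm_eq_sqrt_inner inner_Rd power2_eq_square)

lemma coord_image_Rd: "coord ` Rd d = {x. \<forall>i\<ge>d. x i = 0}"
proof (intro equalityI subsetI)
  fix x :: "nat \<Rightarrow> real" assume x: "x \<in> {x. \<forall>i\<ge>d. x i = 0}"
  then have "{i. x i \<noteq> 0} \<subseteq> {..<d}"
    by (auto simp: not_le[symmetric])
  then have "coord (Abs_finseq x) = x"
    by (intro Abs_finseq_inverse) (auto intro: finite_subset)
  with x have "Abs_finseq x \<in> Rd d" "x = coord (Abs_finseq x)"
    by (auto simp: Rd_def)
  then show "x \<in> coord ` Rd d" by blast
qed (auto simp: Rd_def)

lemma subspace_Rd: "subspace (Rd d)"
  by (auto simp: subspace_def Rd_def)

text \<open>
  Functions on \<open>R^d\<close> are functions on the ambient type of which only the values on \<open>Rd d\<close> matter;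
  derivatives are taken within \<open>Rd d\<close>.
\<close>

definition gradient :: "nat \<Rightarrow> (finseq \<Rightarrow> real) \<Rightarrow> finseq \<Rightarrow> finseq" where
  "gradient d f x =
     (THE g. g \<in> Rd d \<and> (f has_derivative (\<lambda>h. g \<bullet> h)) (at x within Rd d))"

lemma gradient_unique:
  assumes x: "x \<in> Rd d" and g: "g \<in> Rd d" "(f has_derivative (\<lambda>h. g \<bullet> h)) (at x within Rd d)"
    and g': "g' \<in> Rd d" "(f has_derivative (\<lambda>h. g' \<bullet> h)) (at x within Rd d)"
  shows "g = g'"
proof -
  let ?h = "g - g'"
  have h: "?h \<in> Rd d"
    using g(1) g'(1) subspace_Rd by (rule subspace_diff[rotated])
  have line: "((\<lambda>t. x + t *\<^sub>R ?h) has_derivative (\<lambda>t. t *\<^sub>R ?h)) (at 0 within UNIV)"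
    by (auto intro!: derivative_eq_intros)
  have sub: "range (\<lambda>t. x + t *\<^sub>R ?h) \<subseteq> Rd d"
    using x h by (auto intro!: subspace_add subspace_scale subspace_Rd)
  have D: "((\<lambda>t. f (x + t *\<^sub>R ?h)) has_derivative (\<lambda>t. v \<bullet> (t *\<^sub>R ?h))) (at 0)"
    if "(f has_derivative (\<lambda>h. v \<bullet> h)) (at x within Rd d)" for v
    using has_derivative_in_compose[OF line, of f "\<lambda>h. v \<bullet> h"]
      has_derivative_subset[OF that sub] by simp
  have "(\<lambda>t. g \<bullet> (t *\<^sub>R ?h)) = (\<lambda>t. g' \<bullet> (t *\<^sub>R ?h))"
    by (rule has_derivative_unique[OF D[OF g(2)] D[OF g'(2)]])
  then have "g \<bullet> (1 *\<^sub>R ?h) = g' \<bullet> (1 *\<^sub>R ?h)"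
    by meson
  then have "?h \<bullet> ?h = 0"
    by (simp add: inner_diff_left)
  then show ?thesis by simp
qed

lift_definition unit_seq :: "nat \<Rightarrow> finseq" is "\<lambda>j i. if i = j then 1 else 0"
  by simp

lemma coord_sum: "coord (sum X A) i = (\<Sum>j\<in>A. coord (X j) i)"
  by (induction A rule: infinite_finite_induct) auto

lemma Rd_expand:
  assumes "h \<in> Rd d"
  shows "h = (\<Sum>j<d. coord h j *\<^sub>R unit_seq j)"
  using assms by (intro finseq_eqI) (simp add: coord_sum unit_seq.rep_eq Rd_def if_distrib cong: if_cong)

lemma gradient_works:
  assumes f: "f differentiable (at x within Rd d)" and x: "x \<in> Rd d"
  shows "gradient d f x \<in> Rd d"
    and "(f has_derivative (\<lambda>h. gradient d f x \<bullet> h)) (at x within Rd d)"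
proof -
  obtain D where D: "(f has_derivative D) (at x within Rd d)"
    using f by (auto simp: differentiable_def)
  then interpret D: bounded_linear D
    by (rule has_derivative_bounded_linear)
  define g where "g = (\<Sum>j<d. D (unit_seq j) *\<^sub>R unit_seq j)"
  have g: "g \<in> Rd d"
    by (simp add: g_def Rd_def coord_sum unit_seq.rep_eq)
  have gD: "g \<bullet> h = D h" if "h \<in> Rd d" for h
  proof -
    have "D h = (\<Sum>j<d. coord h j * D (unit_seq j))"
      by (subst Rd_expand[OF that]) (simp add: D.sum D.scaleR)
    also have "\<dots> = g \<bullet> h"
      unfolding inner_Rd[OF g]
      by (simp add: g_def coord_sum unit_seq.rep_eq mult.commute if_distrib cong: if_cong)
    finally show ?thesis by simp
  qed
  have "(f has_derivative (\<lambda>h. g \<bullet> h)) (at x within Rd d)"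
    using D x gD unfolding has_derivative_within
    by (auto intro!: bounded_linear_inner_right
        elim!: Lim_transform_eventually simp: eventually_at_filter subspace_diff[OF subspace_Rd])
  with g have "\<exists>!g. g \<in> Rd d \<and> (f has_derivative (\<lambda>h. g \<bullet> h)) (at x within Rd d)"
    using gradient_unique[OF x] by blast
  from theI'[OF this, folded gradient_def]
  show "gradient d f x \<in> Rd d"
    "(f has_derivative (\<lambda>h. gradient d f x \<bullet> h)) (at x within Rd d)" by auto
qed

definition smooth_class :: "nat \<Rightarrow> real \<Rightarrow> (finseq \<Rightarrow> real) set" where
  "smooth_class d L = {f. f differentiable_on Rd d \<and> L-lipschitz_on (Rd d) (gradient d f)}"

definition strongly_convex :: "nat \<Rightarrow> real \<Rightarrow> (finseq \<Rightarrow> real) \<Rightarrow> bool" where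
  "strongly_convex d \<mu> F \<longleftrightarrow>
     (\<forall>x\<in>Rd d. \<forall>y\<in>Rd d. F y \<ge> F x + gradient d F x \<bullet> (y - x) + \<mu> / 2 * (norm (y - x))\<^sup>2)"

definition average :: "nat \<Rightarrow> (nat \<Rightarrow> finseq \<Rightarrow> real) \<Rightarrow> finseq \<Rightarrow> real" where
  "average n f x = (1 / real n) * (\<Sum>i = 1..n. f i x)"

text \<open>
  \<open>inner_iterate d f \<sigma> \<eta> x i\<close> is the iterate after \<open>i\<close> steps of an epoch started at \<open>x\<close>, where
  \<open>\<eta> i\<close> is the step size of the \<open>i\<close>-th step. In \<open>single_shuffle\<close> the step sizes are \<open>\<eta> k i\<close> for
  epoch \<open>k \<ge> 1\<close>, and \<open>single_shuffle d n f \<sigma> \<eta> x\<^sub>0 k\<close> is the point reached after \<open>k\<close>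
  epochs, that is, the starting point of epoch \<open>k + 1\<close>.
\<close>

primrec inner_iterate ::
  "nat \<Rightarrow> (nat \<Rightarrow> finseq \<Rightarrow> real) \<Rightarrow> (nat \<Rightarrow> nat) \<Rightarrow> (nat \<Rightarrow> real) \<Rightarrow> finseq \<Rightarrow> nat \<Rightarrow> finseq"
where
  "inner_iterate d f \<sigma> \<eta> x 0 = x"
| "inner_iterate d f \<sigma> \<eta> x (Suc i) =
     inner_iterate d f \<sigma> \<eta> x i
       - \<eta> (Suc i) *\<^sub>R gradient d (f (\<sigma> (Suc i))) (inner_iterate d f \<sigma> \<eta> x i)"

primrec single_shuffle ::
  "nat \<Rightarrow> nat \<Rightarrow> (nat \<Rightarrow> finseq \<Rightarrow> real) \<Rightarrow> (nat \<Rightarrow> nat) \<Rightarrow> (nat \<Rightarrow> nat \<Rightarrow> real) \<Rightarrow> finseq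
    \<Rightarrow> nat \<Rightarrow> finseq"
where
  "single_shuffle d n f \<sigma> \<eta> x\<^sub>0 0 = x\<^sub>0"
| "single_shuffle d n f \<sigma> \<eta> x\<^sub>0 (Suc k) =
     inner_iterate d f \<sigma> (\<eta> (Suc k)) (single_shuffle d n f \<sigma> \<eta> x\<^sub>0 k) n"

definition random_permutation :: "nat \<Rightarrow> (nat \<Rightarrow> nat) pmf" where
  "random_permutation n = pmf_of_set {\<sigma>. \<sigma> permutes {1..n}}"

end

theory Submission
  imports Defs
begin

text \<open>
  For every fixed permutation, an epoch is a gradient step on \<open>F\<close> of length \<open>\<eta> n\<close>, which contracts
  the distance to the minimizer \<open>z\<close>, up to an error of order \<open>\<eta>\<^sup>2 L S\<close>, where \<open>S\<close> is the sum
  over \<open>i < n\<close> of the norms of the partial sums of the first \<open>i\<close> gradients at \<open>z\<close>. Since the same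
  permutation is used in all epochs, the recursion can be unrolled deterministically: after \<open>K\<close>
  epochs the distance is at most \<open>norm (x - z) / (sqrt n * K)\<close> plus a multiple of \<open>\<eta> L S / (n \<mu>)\<close>.
  Randomness enters only through the second moment of \<open>S\<close>. As the gradients at \<open>z\<close> sum to zero,
  sampling without replacement makes them negatively correlated, so that the expectation of
  \<open>S\<^sup>2\<close> is at most \<open>n\<^sup>3 G\<^sup>2\<close>.
\<close>

section \<open>Sampling without replacement\<close>

text \<open>Composing with a transposition that fixes \<open>j\<close> shows that every index other
  than \<open>j\<close> gives the same sum as \<open>i\<close>. Adding over these indices and using
  \<open>sum v A = 0\<close> turns the total into minus a sum of squared norms.\<close>

lemma sum_permutes_inner_nonpos:
  fixes v :: "'a \<Rightarrow> 'b::real_inner"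
  assumes A: "finite A" "i \<in> A" "j \<in> A" "i \<noteq> j" and v: "sum v A = 0"
  shows "(\<Sum>\<sigma> | \<sigma> permutes A. v (\<sigma> i) \<bullet> v (\<sigma> j)) \<le> 0"
proof -
  let ?P = "{\<sigma>. \<sigma> permutes A}"
  let ?c = "\<lambda>k. \<Sum>\<sigma>\<in>?P. v (\<sigma> k) \<bullet> v (\<sigma> j)"
  have same: "?c k = ?c i" if k: "k \<in> A - {j}" for k
  proof -
    let ?t = "Transposition.transpose i k"
    have t: "?t permutes A"
      using A(2) k by (simp add: permutes_swap_id)
    have "?c i = (\<Sum>\<sigma>\<in>?P. v ((\<sigma> \<circ> ?t) i) \<bullet> v ((\<sigma> \<circ> ?t) j))"
      by (rule sum_permutations_compose_right[OF t])
    also have "\<dots> = ?c k"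
      using A(4) k by (intro sum.cong) (auto simp: Transposition.transpose_def)
    finally show ?thesis by simp
  qed
  have "real (card (A - {j})) * ?c i = (\<Sum>k\<in>A - {j}. ?c k)"
    using same by simp
  also have "\<dots> = (\<Sum>\<sigma>\<in>?P. (\<Sum>k\<in>A - {j}. v (\<sigma> k)) \<bullet> v (\<sigma> j))"
    by (subst sum.swap) (simp add: inner_sum_left)
  also have "\<dots> = (\<Sum>\<sigma>\<in>?P. - (v (\<sigma> j) \<bullet> v (\<sigma> j)))"
  proof (rule sum.cong[OF refl])
    fix \<sigma> assume "\<sigma> \<in> ?P"
    then have "(\<Sum>k\<in>A. v (\<sigma> k)) = 0"
      using sum.permute[of \<sigma> A v] v by (simp add: o_def)
    then have "(\<Sum>k\<in>A - {j}. v (\<sigma> k)) = - v (\<sigma> j)"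
      using A by (simp add: sum_diff1)
    then show "(\<Sum>k\<in>A - {j}. v (\<sigma> k)) \<bullet> v (\<sigma> j) = - (v (\<sigma> j) \<bullet> v (\<sigma> j))"
      by simp
  qed
  also have "\<dots> \<le> 0"
    by (intro sum_nonpos) simp
  finally have "real (card (A - {j})) * ?c i \<le> 0" .
  moreover have "card (A - {j}) > 0"
    unfolding card_gt_0_iff using A by blast
  ultimately show ?thesis
    by (simp add: mult_le_0_iff)
qed

text \<open>After expanding the square, the off-diagonal terms are nonpositive by negative
  correlation, so only the diagonal counts: the bound grows linearly in \<open>card B\<close>, not
  quadratically as with the triangle inequality.\<close>

lemma sum_permutes_norm_sum_le:
  fixes v :: "'a \<Rightarrow> 'b::real_inner"
  assumes A: "finite A" "B \<subseteq> A" and v: "sum v A = 0" and G: "\<And>a. a \<in> A \<Longrightarrow> norm (v a) \<le> G"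
  shows "(\<Sum>\<sigma> | \<sigma> permutes A. (norm (\<Sum>j\<in>B. v (\<sigma> j)))\<^sup>2) \<le> fact (card A) * (real (card B) * G\<^sup>2)"
proof -
  let ?P = "{\<sigma>. \<sigma> permutes A}"
  have B: "finite B"
    using A finite_subset by blast
  have cardP: "real (card ?P) = fact (card A)"
    using A by (simp add: card_permutations)
  have "(\<Sum>\<sigma>\<in>?P. (norm (\<Sum>j\<in>B. v (\<sigma> j)))\<^sup>2)
      = (\<Sum>\<sigma>\<in>?P. \<Sum>i\<in>B. \<Sum>j\<in>B. v (\<sigma> i) \<bullet> v (\<sigma> j))"
    by (simp add: power2_norm_eq_inner inner_sum_left inner_sum_right inner_commute)
  also have "\<dots> = (\<Sum>i\<in>B. \<Sum>j\<in>B. \<Sum>\<sigma>\<in>?P. v (\<sigma> i) \<bullet> v (\<sigma> j))"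
    by (subst sum.swap, intro sum.cong refl, rule sum.swap)
  also have "\<dots> \<le> (\<Sum>i\<in>B. \<Sum>j\<in>B. if j = i then fact (card A) * G\<^sup>2 else 0)"
  proof (intro sum_mono)
    fix i j assume ij: "i \<in> B" "j \<in> B"
    show "(\<Sum>\<sigma>\<in>?P. v (\<sigma> i) \<bullet> v (\<sigma> j)) \<le> (if j = i then fact (card A) * G\<^sup>2 else 0)"
    proof (cases "j = i")
      case True
      have "(\<Sum>\<sigma>\<in>?P. v (\<sigma> i) \<bullet> v (\<sigma> i)) \<le> (\<Sum>\<sigma>\<in>?P. G\<^sup>2)"
      proof (rule sum_mono)
        fix \<sigma> assume "\<sigma> \<in> ?P"
        then have "\<sigma> i \<in> A"
          using ij A by (auto simp: permutes_in_image)
        then show "v (\<sigma> i) \<bullet> v (\<sigma> i) \<le> G\<^sup>2"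
          using power_mono[OF G norm_ge_zero, of "\<sigma> i" 2] by (simp add: power2_norm_eq_inner)
      qed
      then show ?thesis
        using True cardP by simp
    next
      case False
      then show ?thesis
        using sum_permutes_inner_nonpos[of A i j v] ij A v by auto
    qed
  qed
  also have "\<dots> = fact (card A) * (real (card B) * G\<^sup>2)"
    using B by simp
  finally show ?thesis .
qed

section \<open>One epoch as a perturbed gradient step, and iteration of its bound\<close>

lemma norm_sum_lipschitz_diff_le:
  assumes "\<And>j. j < n \<Longrightarrow> L-lipschitz_on S (g j)"
    and "\<And>j. j < n \<Longrightarrow> y j \<in> S" and "\<And>j. j < n \<Longrightarrow> w j \<in> S"
  shows "norm (\<Sum>j<n. g j (y j) - g j (w j)) \<le> L * (\<Sum>j<(n::nat). norm (y j - w j))"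
proof -
  have "norm (\<Sum>j<n. g j (y j) - g j (w j)) \<le> (\<Sum>j<n. L * norm (y j - w j))"
    using assms by (intro sum_norm_le) (auto simp: dist_norm[symmetric] intro: lipschitz_onD)
  then show ?thesis
    by (simp add: sum_distrib_left)
qed

lemma incremental_step_sum:
  fixes y :: "nat \<Rightarrow> 'a::real_vector"
  assumes "\<And>i. i < n \<Longrightarrow> y (Suc i) = y i - \<eta> *\<^sub>R g i (y i)" and "i \<le> n"
  shows "y i = y 0 - \<eta> *\<^sub>R (\<Sum>j<i. g j (y j))"
  using assms(2) by (induction i) (auto simp: assms(1) algebra_simps)

text \<open>A displacement is \<eta> times a partial sum of gradients, which splits into a Lipschitz
  difference from the gradients at \<open>z\<close> and the partial sum at \<open>z\<close>. The
  difference is bounded through the total displacement itself, which is then absorbed.\<close>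

lemma epoch_deviation:
  fixes y :: "nat \<Rightarrow> 'a::real_normed_vector"
  assumes step: "\<And>i. i < n \<Longrightarrow> y (Suc i) = y i - \<eta> *\<^sub>R g i (y i)"
    and lip: "\<And>i. i < n \<Longrightarrow> L-lipschitz_on S (g i)"
    and S: "z \<in> S" "\<And>i. i < n \<Longrightarrow> y i \<in> S"
    and \<eta>: "\<eta> \<ge> 0" "L \<ge> 0" "real n * \<eta> * L \<le> 1 / 5"
  shows "(\<Sum>i<n. norm (y i - y 0))
    \<le> 5 / 4 * \<eta> * (L * (real n)\<^sup>2 * norm (y 0 - z) + (\<Sum>i<n. norm (\<Sum>j<i. g j z)))"
proof -
  define A where "A = (\<Sum>i<n. norm (y i - y 0))"
  define D where "D = norm (y 0 - z)"
  define P where "P = (\<lambda>i. norm (\<Sum>j<i. g j z))"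
  have bound: "norm (y i - y 0) \<le> \<eta> * (L * (A + real n * D)) + \<eta> * P i" if i: "i < n" for i
  proof -
    have "norm (\<Sum>j<i. g j (y j) - g j z) \<le> L * (\<Sum>j<i. norm (y j - z))"
      using i lip S by (intro norm_sum_lipschitz_diff_le[of _ L S]) auto
    also have "\<dots> \<le> L * (\<Sum>j<n. norm (y j - z))"
      using i \<eta> by (intro mult_left_mono sum_mono2) auto
    also have "\<dots> \<le> L * (\<Sum>j<n. norm (y j - y 0) + D)"
      unfolding D_def using \<eta> norm_triangle_ineq[of "y j - y 0" "y 0 - z" for j]
      by (intro mult_left_mono sum_mono) auto
    also have "\<dots> = L * (A + real n * D)"
      by (simp add: A_def sum.distrib)
    finally have *: "norm (\<Sum>j<i. g j (y j) - g j z) \<le> L * (A + real n * D)" .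
    have "norm (y i - y 0) = norm (\<eta> *\<^sub>R ((\<Sum>j<i. g j (y j) - g j z) + (\<Sum>j<i. g j z)))"
      using incremental_step_sum[where y = y and g = g, OF step, of n i] i by (simp add: sum_subtractf)
    also have "\<dots> \<le> \<eta> * (norm (\<Sum>j<i. g j (y j) - g j z) + P i)"
      unfolding P_def using \<eta> norm_triangle_ineq by (auto intro!: mult_left_mono)
    also have "\<dots> \<le> \<eta> * (L * (A + real n * D) + P i)"
      using * \<eta> by (intro mult_left_mono) auto
    finally show ?thesis
      by (simp add: distrib_left)
  qed
  have "A \<le> (\<Sum>i<n. \<eta> * (L * (A + real n * D)) + \<eta> * P i)"
    unfolding A_def[symmetric] by (subst A_def, intro sum_mono bound) auto
  also have "\<dots> = (real n * \<eta> * L) * A + \<eta> * (L * (real n)\<^sup>2 * D + (\<Sum>i<n. P i))"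
    by (simp add: sum.distrib sum_distrib_left power2_eq_square algebra_simps)
  \<comment> \<open>The inequality is implicit in \<open>A\<close>; moving \<open>A / 5\<close> to
    the left yields the factor 5/4.\<close>
  also have "(real n * \<eta> * L) * A \<le> 1 / 5 * A"
    using \<eta> by (intro mult_right_mono) (auto simp: A_def sum_nonneg)
  finally show ?thesis
    by (simp add: A_def D_def P_def)
qed

text \<open>The end of the epoch is an exact step along the full sum \<open>s\<close> of gradients
  at \<open>y 0\<close>, minus \<eta> times the error \<open>e\<close> caused by evaluating the
  gradients at drifting points. Strong monotonicity makes the exact step contract, and the deviation
  bound controls the error.\<close>

lemma epoch_contraction:
  fixes y :: "nat \<Rightarrow> 'a::real_inner"
  assumes step: "\<And>i. i < n \<Longrightarrow> y (Suc i) = y i - \<eta> *\<^sub>R g i (y i)"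
    and lip: "\<And>i. i < n \<Longrightarrow> L-lipschitz_on S (g i)"
    and S: "z \<in> S" "\<And>i. i < n \<Longrightarrow> y i \<in> S"
    and \<eta>: "\<eta> \<ge> 0" "L \<ge> 0" "real n * \<eta> * L \<le> 1 / 5" "real n * \<eta> * L\<^sup>2 \<le> \<mu> / 5"
    and \<mu>: "0 \<le> \<mu>" "\<mu> \<le> L"
    and n: "n > 0"
    and mono: "real n * \<mu> * (norm (y 0 - z))\<^sup>2 \<le> (\<Sum>i<n. g i (y 0)) \<bullet> (y 0 - z)"
    and z: "(\<Sum>i<n. g i z) = 0"
  shows "norm (y n - z) \<le> (1 - \<eta> * real n * \<mu> / 2) * norm (y 0 - z)
    + 5 / 4 * \<eta>\<^sup>2 * L * (\<Sum>i<n. norm (\<Sum>j<i. g j z))"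
proof -
  define D where "D = norm (y 0 - z)"
  define Q where "Q = (\<Sum>i<n. norm (\<Sum>j<i. g j z))"
  define r where "r = \<eta> * real n * \<mu>"
  define s where "s = (\<Sum>j<n. g j (y 0))"
  define e where "e = (\<Sum>j<n. g j (y j) - g j (y 0))"
  have y0: "y 0 \<in> S"
    using S n by blast
  have D: "D \<ge> 0" by (simp add: D_def)
  have r: "0 \<le> r"
    using \<eta> \<mu> by (simp add: r_def)
  have "\<eta> * real n * \<mu> \<le> \<eta> * real n * L"
    using \<eta> \<mu> by (intro mult_left_mono) auto
  then have r1: "r \<le> 1 / 5"
    using \<eta>(3) by (simp add: r_def mult.commute)
  \<comment> \<open>The step size is of order \<mu> / (n L^2), so second-order terms are a small
    fraction of the first-order gain 2r.\<close>
  have q: "(\<eta> * real n * L)\<^sup>2 \<le> r / 5"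
  proof -
    have "(\<eta> * real n * L)\<^sup>2 = \<eta> * real n * (real n * \<eta> * L\<^sup>2)"
      by (simp add: power2_eq_square)
    also have "\<dots> \<le> \<eta> * real n * (\<mu> / 5)"
      using \<eta> by (intro mult_left_mono) auto
    finally show ?thesis by (simp add: r_def)
  qed
  have "s = (\<Sum>j<n. g j (y 0) - g j z)"
    using z by (simp add: s_def sum_subtractf)
  moreover have "norm \<dots> \<le> L * (\<Sum>j<n. D)"
    unfolding D_def by (rule norm_sum_lipschitz_diff_le[OF lip]) (use y0 S in auto)
  ultimately have "\<eta> * norm s \<le> \<eta> * (L * (\<Sum>j<n. D))"
    using \<eta> by (intro mult_left_mono) auto
  then have s: "\<eta> * norm s \<le> \<eta> * real n * L * D"
    by (simp add: mult_ac)
  have "(norm (u - \<eta> *\<^sub>R s))\<^sup>2 = (norm u)\<^sup>2 - 2 * \<eta> * (s \<bullet> u) + (\<eta> * norm s)\<^sup>2" for u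
    unfolding power_mult_distrib power2_norm_eq_inner
    by (simp add: inner_diff_left inner_diff_right inner_commute[of u s] power2_eq_square
        right_diff_distrib)
  from this[of "y 0 - z"] have "(norm (y 0 - z - \<eta> *\<^sub>R s))\<^sup>2
      = D\<^sup>2 - 2 * \<eta> * (s \<bullet> (y 0 - z)) + (\<eta> * norm s)\<^sup>2"
    by (simp add: D_def)
  also have "(\<eta> * norm s)\<^sup>2 \<le> (\<eta> * real n * L * D)\<^sup>2"
    using s \<eta> by (intro power_mono) auto
  also have "\<dots> \<le> r / 5 * D\<^sup>2"
    using mult_right_mono[OF q, of "D\<^sup>2"] by (simp add: power_mult_distrib)
  also have "D\<^sup>2 - 2 * \<eta> * (s \<bullet> (y 0 - z)) \<le> D\<^sup>2 - 2 * r * D\<^sup>2"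
    using mult_left_mono[OF mono, of "2 * \<eta>"] \<eta> by (simp add: s_def D_def r_def algebra_simps)
  \<comment> \<open>The rate 9/10 is half of 2 - 1/5; the square on the right only adds a
    nonnegative term in r^2.\<close>
  also have "D\<^sup>2 - 2 * r * D\<^sup>2 + r / 5 * D\<^sup>2 \<le> ((1 - 9 / 10 * r) * D)\<^sup>2"
    using D r by (simp add: power2_eq_square algebra_simps)
  finally have "norm (y 0 - z - \<eta> *\<^sub>R s) \<le> (1 - 9 / 10 * r) * D"
    using r1 D by (intro power2_le_imp_le[of "norm _"]) auto
  moreover have "\<eta> * norm e \<le> r / 4 * D + 5 / 4 * \<eta>\<^sup>2 * L * Q"
  proof -
    have "norm e \<le> L * (\<Sum>j<n. norm (y j - y 0))"
      unfolding e_def by (rule norm_sum_lipschitz_diff_le[OF lip]) (use y0 S in auto)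
    also have "\<dots> \<le> L * (5 / 4 * \<eta> * (L * (real n)\<^sup>2 * D + Q))"
      unfolding D_def Q_def using epoch_deviation[where y = y and g = g, OF step lip S \<eta>(1-3)] \<eta>
      by (intro mult_left_mono) auto
    finally have "\<eta> * norm e \<le> \<eta> * (L * (5 / 4 * \<eta> * (L * (real n)\<^sup>2 * D + Q)))"
      using \<eta> by (intro mult_left_mono) auto
    also have "\<dots> = 5 / 4 * (\<eta> * real n * L)\<^sup>2 * D + 5 / 4 * \<eta>\<^sup>2 * L * Q"
      by (simp add: power2_eq_square algebra_simps)
    also have "\<dots> \<le> r / 4 * D + 5 / 4 * \<eta>\<^sup>2 * L * Q"
      using q D by (intro add_right_mono mult_right_mono) auto
    finally show ?thesis .
  qed
  moreover have yn: "y n - z = (y 0 - z - \<eta> *\<^sub>R s) - \<eta> *\<^sub>R e"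
    using incremental_step_sum[where y = y and g = g, OF step, of n n]
    by (simp add: s_def e_def sum_subtractf algebra_simps)
  have "norm (y n - z) \<le> norm (y 0 - z - \<eta> *\<^sub>R s) + \<eta> * norm e"
    unfolding yn using norm_triangle_ineq4[of "y 0 - z - \<eta> *\<^sub>R s" "\<eta> *\<^sub>R e"] \<eta> by simp
  ultimately have "norm (y n - z) \<le> (1 - 9 / 10 * r + r / 4) * D + 5 / 4 * \<eta>\<^sup>2 * L * Q"
    by (simp add: algebra_simps)
  \<comment> \<open>The drift costs r/4, and 9/10 - 1/4 = 13/20 still exceeds 1/2.\<close>
  also have "(1 - 9 / 10 * r + r / 4) * D \<le> (1 - r / 2) * D"
    using r D by (intro mult_right_mono) auto
  finally show ?thesis
    by (simp add: D_def Q_def r_def)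
qed

text \<open>\<open>B / \<rho>\<close> is the fixed point of the affine map, so any excess over it
  shrinks by 1 - \<rho> in each step.\<close>

lemma affine_recursion_le:
  fixes D :: "nat \<Rightarrow> real"
  assumes step: "\<And>k. D (Suc k) \<le> (1 - \<rho>) * D k + B" and \<rho>: "0 < \<rho>" "\<rho> \<le> 1"
    and D: "D 0 \<ge> 0" and B: "B \<ge> 0"
  shows "D k \<le> exp (- \<rho> * real k) * D 0 + B / \<rho>"
proof -
  have "D k \<le> (1 - \<rho>) ^ k * D 0 + B / \<rho>"
  proof (induction k)
    case 0
    then show ?case using \<rho> B by simp
  next
    case (Suc k)
    have "D (Suc k) \<le> (1 - \<rho>) * ((1 - \<rho>) ^ k * D 0 + B / \<rho>) + B"
      using step[of k] mult_left_mono[OF Suc, of "1 - \<rho>"] \<rho> by linarith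
    also have "\<dots> = (1 - \<rho>) ^ Suc k * D 0 + B / \<rho>"
      using \<rho> by (simp add: field_simps)
    finally show ?case .
  qed
  moreover have "(1 - \<rho>) ^ k \<le> exp (- \<rho>) ^ k"
    using exp_ge_add_one_self[of "- \<rho>"] \<rho> by (intro power_mono) auto
  ultimately show ?thesis
    using mult_right_mono[of "(1 - \<rho>) ^ k" "exp (- \<rho>) ^ k" "D 0"] D
    by (simp add: exp_of_nat_mult[symmetric] mult.commute)
qed

section \<open>Smoothness and strong convexity of the average\<close>

context
  fixes d n :: nat and f :: "nat \<Rightarrow> finseq \<Rightarrow> real" and L :: real
  assumes n: "n > 0" and smooth: "\<And>i. i \<in> {1..n} \<Longrightarrow> f i \<in> smooth_class d L"
begin

text \<open>The gradient is a definite description, so linearity is obtained from uniqueness: the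
  averaged vector lies in \<open>Rd d\<close> and represents the derivative.\<close>

lemma gradient_average:
  assumes x: "x \<in> Rd d"
  shows "gradient d (average n f) x = (1 / real n) *\<^sub>R (\<Sum>i=1..n. gradient d (f i) x)"
    (is "_ = ?g")
proof -
  have diff: "f i differentiable (at x within Rd d)" if "i \<in> {1..n}" for i
    using smooth[OF that] x by (auto simp: smooth_class_def differentiable_on_def)
  have "?g \<in> Rd d"
    by (intro subspace_scale[OF subspace_Rd] subspace_sum[OF subspace_Rd] gradient_works(1) diff x)
  moreover have "(average n f has_derivative
      (\<lambda>h. (1 / real n) * (\<Sum>i=1..n. gradient d (f i) x \<bullet> h))) (at x within Rd d)"
    unfolding average_def[abs_def]
    by (intro has_derivative_mult_right has_derivative_sum gradient_works(2) diff x)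
  then have "(average n f has_derivative (\<lambda>h. ?g \<bullet> h)) (at x within Rd d)"
    by (simp add: inner_sum_left)
  ultimately show ?thesis
    using gradient_works[OF _ x, of "average n f"] gradient_unique[OF x]
    by (metis differentiable_def)
qed

lemma gradient_average_lipschitz:
  assumes x: "x \<in> Rd d" and y: "y \<in> Rd d"
  shows "norm (gradient d (average n f) x - gradient d (average n f) y) \<le> L * norm (x - y)"
proof -
  have "norm (\<Sum>j<n. gradient d (f (Suc j)) x - gradient d (f (Suc j)) y) \<le> L * (\<Sum>j<n. norm (x - y))"
    using x y smooth by (intro norm_sum_lipschitz_diff_le[of _ L "Rd d"]) (auto simp: smooth_class_def)
  then show ?thesis
    using x y n
    by (simp add: gradient_average scaleR_diff_right[symmetric] sum_subtractf[symmetric]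
        sum.atLeast1_atMost_eq field_simps)
qed

text \<open>Let \<open>y\<close> be one gradient step from \<open>z\<close>. Minimality of
  \<open>z\<close> and the convexity inequality at \<open>y\<close> force the gradients at
  \<open>y\<close> and \<open>z\<close> to have nonpositive inner product, while smoothness keeps
  them close; both hold only if the gradient at \<open>z\<close> vanishes.\<close>

lemma gradient_average_argmin:
  assumes sc: "strongly_convex d \<mu> (average n f)" and \<mu>: "\<mu> \<ge> 0" and L: "L > 0"
    and min: "is_arg_min (average n f) (\<lambda>x. x \<in> Rd d) z"
  shows "gradient d (average n f) z = 0"
proof -
  let ?F = "average n f" and ?g = "gradient d (average n f)"
  have z: "z \<in> Rd d"
    using min by (simp add: is_arg_min_def)
  have gz: "?g z \<in> Rd d"
    unfolding gradient_average[OF z] using smooth z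
    by (intro subspace_scale[OF subspace_Rd] subspace_sum[OF subspace_Rd] gradient_works(1))
      (auto simp: smooth_class_def differentiable_on_def)
  \<comment> \<open>This length makes the two gradients differ by at most half the norm of the one
    at \<open>z\<close>.\<close>
  define t where "t = 1 / (2 * L)"
  define y where "y = z - t *\<^sub>R ?g z"
  have y: "y \<in> Rd d"
    unfolding y_def by (intro subspace_diff[OF subspace_Rd] subspace_scale[OF subspace_Rd] z gz)
  have t: "t > 0" using L by (simp add: t_def)
  have "?F z \<le> ?F y"
    using min y by (auto simp: is_arg_min_def not_less)
  moreover have "?F z \<ge> ?F y + ?g y \<bullet> (z - y) + \<mu> / 2 * (norm (z - y))\<^sup>2"
    using sc y z by (simp add: strongly_convex_def)
  moreover have "\<mu> / 2 * (norm (z - y))\<^sup>2 \<ge> 0"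
    using \<mu> by simp
  moreover have "?g y \<bullet> (z - y) = t * (?g y \<bullet> ?g z)"
    by (simp add: y_def)
  ultimately have "t * (?g y \<bullet> ?g z) \<le> 0"
    by linarith
  then have "?g y \<bullet> ?g z \<le> 0"
    using t by (simp add: mult_le_0_iff)
  then have "(norm (?g z))\<^sup>2 \<le> (?g z - ?g y) \<bullet> ?g z"
    by (simp add: inner_diff_left power2_norm_eq_inner)
  also have "\<dots> \<le> norm (?g z - ?g y) * norm (?g z)"
    by (rule norm_cauchy_schwarz)
  also have "\<dots> \<le> L * norm (z - y) * norm (?g z)"
    by (intro mult_right_mono gradient_average_lipschitz z y) auto
  also have "\<dots> = (norm (?g z))\<^sup>2 / 2"
    using t L by (simp add: y_def t_def power2_eq_square)
  finally show ?thesis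
    by simp
qed

end

text \<open>Add the two strong convexity inequalities with the points exchanged.\<close>

lemma strongly_convex_monotone:
  assumes sc: "strongly_convex d \<mu> F" and x: "x \<in> Rd d" and y: "y \<in> Rd d"
  shows "\<mu> * (norm (x - y))\<^sup>2 \<le> (gradient d F x - gradient d F y) \<bullet> (x - y)"
proof -
  have "F y \<ge> F x + gradient d F x \<bullet> (y - x) + \<mu> / 2 * (norm (x - y))\<^sup>2"
    "F x \<ge> F y + gradient d F y \<bullet> (x - y) + \<mu> / 2 * (norm (x - y))\<^sup>2"
    using sc x y by (auto simp: strongly_convex_def norm_minus_commute)
  then show ?thesis
    by (simp add: algebra_simps)
qed

section \<open>SingleShuffle for a fixed permutation\<close>

lemma inner_iterate_in_Rd:
  assumes "\<And>i. i \<in> {1..n} \<Longrightarrow> f (\<sigma> i) \<in> smooth_class d L" and "x \<in> Rd d" and "i \<le> n"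
  shows "inner_iterate d f \<sigma> \<eta> x i \<in> Rd d"
  using assms(3)
proof (induction i)
  case (Suc i)
  then have *: "inner_iterate d f \<sigma> \<eta> x i \<in> Rd d" by simp
  moreover have "f (\<sigma> (Suc i)) \<in> smooth_class d L"
    using assms(1) Suc.prems by simp
  ultimately have "gradient d (f (\<sigma> (Suc i))) (inner_iterate d f \<sigma> \<eta> x i) \<in> Rd d"
    by (intro gradient_works(1)) (auto simp: smooth_class_def differentiable_on_def)
  with * show ?case
    by (auto intro!: subspace_diff[OF subspace_Rd] subspace_scale[OF subspace_Rd])
qed (use assms in simp)

lemma single_shuffle_in_Rd:
  assumes "\<And>i. i \<in> {1..n} \<Longrightarrow> f (\<sigma> i) \<in> smooth_class d L" and "x \<in> Rd d"
  shows "single_shuffle d n f \<sigma> \<eta> x k \<in> Rd d"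
  by (induction k) (auto intro!: inner_iterate_in_Rd assms)

text \<open>Reusing one permutation makes the error \<open>Q\<close> the same number in all epochs,
  so the epoch bound is an affine recursion with constant coefficients.\<close>

lemma single_shuffle_distance:
  assumes \<sigma>: "\<sigma> permutes {1..n}" and n: "n > 0"
    and smooth: "\<And>i. i \<in> {1..n} \<Longrightarrow> f i \<in> smooth_class d L"
    and sc: "strongly_convex d \<mu> (average n f)"
    and z: "z \<in> Rd d" "gradient d (average n f) z = 0" and x: "x \<in> Rd d"
    and \<mu>: "0 < \<mu>" "\<mu> \<le> L"
    and \<eta>: "\<eta> > 0" "real n * \<eta> * L \<le> 1 / 5" "real n * \<eta> * L\<^sup>2 \<le> \<mu> / 5"
  shows "norm (single_shuffle d n f \<sigma> (\<lambda>_ _. \<eta>) x k - z)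
    \<le> exp (- (\<eta> * real n * \<mu> / 2) * real k) * norm (x - z)
      + 5 / 2 * \<eta> * L / (real n * \<mu>) * (\<Sum>i<n. norm (\<Sum>j=1..i. gradient d (f (\<sigma> j)) z))"
proof -
  define \<rho> where "\<rho> = \<eta> * real n * \<mu> / 2"
  define Q where "Q = (\<Sum>i<n. norm (\<Sum>j=1..i. gradient d (f (\<sigma> j)) z))"
  define X where "X = single_shuffle d n f \<sigma> (\<lambda>_ _. \<eta>) x"
  \<comment> \<open>The algorithm numbers its steps from 1, the epoch lemmas number them from
    0.\<close>
  let ?g = "\<lambda>j. gradient d (f (\<sigma> (Suc j)))"
  have smooth': "f (\<sigma> i) \<in> smooth_class d L" if "i \<in> {1..n}" for i
    using smooth permutes_in_image[OF \<sigma>] that by blast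
  \<comment> \<open>At a common point the order of the components is irrelevant, so strong convexity
    of the average applies to the whole epoch.\<close>
  have total: "(\<Sum>j<n. ?g j w) = real n *\<^sub>R gradient d (average n f) w" if w: "w \<in> Rd d" for w
  proof -
    have "(\<Sum>j<n. ?g j w) = (\<Sum>j=1..n. gradient d (f j) w)"
      using sum.permute[OF \<sigma>, of "\<lambda>j. gradient d (f j) w"]
      by (simp add: sum.atLeast1_atMost_eq)
    then show ?thesis
      using n by (subst gradient_average[OF n smooth w]) auto
  qed
  have XRd: "X k \<in> Rd d" for k
    unfolding X_def by (intro single_shuffle_in_Rd[of n f \<sigma> d L] smooth' x)
  have step: "norm (X (Suc k) - z) \<le> (1 - \<rho>) * norm (X k - z) + 5 / 4 * \<eta>\<^sup>2 * L * Q" for k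
  proof -
    let ?y = "inner_iterate d f \<sigma> (\<lambda>_. \<eta>) (X k)"
    have "norm (?y n - z) \<le> (1 - \<eta> * real n * \<mu> / 2) * norm (?y 0 - z)
      + 5 / 4 * \<eta>\<^sup>2 * L * (\<Sum>i<n. norm (\<Sum>j<i. ?g j z))"
    proof (rule epoch_contraction[where S = "Rd d"])
      show "L-lipschitz_on (Rd d) (?g i)" if "i < n" for i
        using smooth'[of "Suc i"] that by (simp add: smooth_class_def)
      show "?y i \<in> Rd d" if "i < n" for i
        using that by (intro inner_iterate_in_Rd[of n f \<sigma> d L] smooth' XRd) auto
      show "real n * \<mu> * (norm (?y 0 - z))\<^sup>2 \<le> (\<Sum>i<n. ?g i (?y 0)) \<bullet> (?y 0 - z)"
        using strongly_convex_monotone[OF sc XRd[of k] z(1)] z n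
        by (simp add: total XRd mult.assoc mult_left_mono)
      show "(\<Sum>i<n. ?g i z) = 0"
        using z by (simp add: total)
    qed (use \<mu> \<eta> z n in auto)
    then show ?thesis
      by (simp add: X_def Q_def \<rho>_def sum.atLeast1_atMost_eq)
  qed
  have "\<eta> * real n * \<mu> \<le> \<eta> * real n * L"
    using \<eta> \<mu> by (intro mult_left_mono) auto
  then have "\<rho> \<le> 1"
    using \<eta>(2) by (simp add: \<rho>_def mult.commute)
  moreover have "\<rho> > 0" using \<eta> n \<mu> by (simp add: \<rho>_def)
  moreover have "5 / 4 * \<eta>\<^sup>2 * L * Q \<ge> 0"
    using \<mu> by (simp add: Q_def sum_nonneg)
  ultimately have "norm (X k - z) \<le> exp (- \<rho> * real k) * norm (X 0 - z) + 5 / 4 * \<eta>\<^sup>2 * L * Q / \<rho>"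
    using affine_recursion_le[of "\<lambda>k. norm (X k - z)", OF step] by simp
  also have "5 / 4 * \<eta>\<^sup>2 * L * Q / \<rho> = 5 / 2 * \<eta> * L / (real n * \<mu>) * Q"
    using \<eta> n \<mu> by (simp add: \<rho>_def power2_eq_square field_simps)
  finally show ?thesis
    by (simp add: X_def \<rho>_def Q_def)
qed

text \<open>Along a nonzero vector, which exists as \<open>d \<ge> 1\<close>, the change of the
  gradient is bounded below by \<mu> and above by \<open>L\<close>.\<close>

lemma strong_convexity_le_smoothness:
  assumes n: "n > 0" and d: "d \<ge> 1"
    and smooth: "\<And>i. i \<in> {1..n} \<Longrightarrow> f i \<in> smooth_class d L"
    and sc: "strongly_convex d \<mu> (average n f)"
  shows "\<mu> \<le> L"
proof -
  let ?g = "gradient d (average n f)" and ?e = "unit_seq 0"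
  have e: "?e \<in> Rd d" and z: "0 \<in> Rd d"
    using d by (auto simp: Rd_def unit_seq.rep_eq)
  have "coord ?e 0 \<noteq> coord 0 0"
    by (simp add: unit_seq.rep_eq)
  then have "?e \<noteq> 0"
    by metis
  have "\<mu> * (norm (?e - 0))\<^sup>2 \<le> (?g ?e - ?g 0) \<bullet> (?e - 0)"
    by (rule strongly_convex_monotone[OF sc e z])
  also have "\<dots> \<le> norm (?g ?e - ?g 0) * norm (?e - 0)"
    by (rule norm_cauchy_schwarz)
  also have "\<dots> \<le> L * norm (?e - 0) * norm (?e - 0)"
    by (intro mult_right_mono gradient_average_lipschitz[OF n smooth e z]) auto
  finally show ?thesis
    using \<open>?e \<noteq> 0\<close> by (simp add: power2_eq_square mult.assoc)
qed

text \<open>The convexity inequality at \<open>x\<close>, evaluated at \<open>z\<close>, bounds the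
  gap by an inner product with a gradient difference. The constant \<open>L\<close> suffices, since
  doubling it when a sum is squared gives the 2L of the final bound.\<close>

lemma average_gap_le:
  assumes n: "n > 0" and smooth: "\<And>i. i \<in> {1..n} \<Longrightarrow> f i \<in> smooth_class d L"
    and sc: "strongly_convex d \<mu> (average n f)" and \<mu>: "\<mu> \<ge> 0"
    and z: "z \<in> Rd d" "gradient d (average n f) z = 0" and x: "x \<in> Rd d"
  shows "average n f x - average n f z \<le> L * (norm (x - z))\<^sup>2"
proof -
  let ?g = "gradient d (average n f)"
  have "average n f z \<ge> average n f x + ?g x \<bullet> (z - x) + \<mu> / 2 * (norm (z - x))\<^sup>2"
    using sc x z by (simp add: strongly_convex_def)
  moreover have "\<mu> / 2 * (norm (z - x))\<^sup>2 \<ge> 0"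
    using \<mu> by simp
  ultimately have "average n f x - average n f z \<le> (?g x - ?g z) \<bullet> (x - z)"
    using z by (simp add: inner_diff_right)
  also have "\<dots> \<le> norm (?g x - ?g z) * norm (x - z)"
    by (rule norm_cauchy_schwarz)
  also have "\<dots> \<le> L * norm (x - z) * norm (x - z)"
    by (intro mult_right_mono gradient_average_lipschitz[OF n smooth x z(1)]) auto
  finally show ?thesis
    by (simp add: power2_eq_square mult.assoc)
qed

section \<open>Averaging over the permutation\<close>

lemma expectation_random_permutation:
  fixes h :: "(nat \<Rightarrow> nat) \<Rightarrow> real"
  shows "measure_pmf.expectation (random_permutation n) h
    = (\<Sum>\<sigma> | \<sigma> permutes {1..n}. h \<sigma>) / fact n"
proof -
  have "{\<sigma>. \<sigma> permutes {1..n}} \<noteq> {}"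
    using permutes_id by blast
  then show ?thesis
    unfolding random_permutation_def
    by (subst integral_pmf_of_set) (auto simp: finite_permutations card_permutations)
qed

text \<open>Cauchy-Schwarz over the \<open>n\<close> partial sums costs one factor \<open>n\<close>,
  their number another, and each mean square a third by negative correlation. The triangle
  inequality alone would give n^4, losing the factor 1/n of the rate.\<close>

lemma expectation_partial_sums_le:
  fixes v :: "nat \<Rightarrow> 'b::real_inner"
  assumes v: "sum v {1..n} = 0" and G: "\<And>i. i \<in> {1..n} \<Longrightarrow> norm (v i) \<le> G"
  shows "measure_pmf.expectation (random_permutation n)
      (\<lambda>\<sigma>. (\<Sum>i<n. norm (\<Sum>j=1..i. v (\<sigma> j)))\<^sup>2) \<le> (real n) ^ 3 * G\<^sup>2"
proof -
  let ?P = "{\<sigma>. \<sigma> permutes {1..n}}"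
  have "(\<Sum>\<sigma>\<in>?P. (\<Sum>i<n. norm (\<Sum>j=1..i. v (\<sigma> j)))\<^sup>2)
      \<le> (\<Sum>\<sigma>\<in>?P. real n * (\<Sum>i<n. (norm (\<Sum>j=1..i. v (\<sigma> j)))\<^sup>2))"
    by (intro sum_mono order_trans[OF sum_squared_le_sum_of_squares]) (simp add: mult.commute)
  also have "\<dots> = real n * (\<Sum>i<n. \<Sum>\<sigma>\<in>?P. (norm (\<Sum>j\<in>{1..i}. v (\<sigma> j)))\<^sup>2)"
    by (subst sum.swap) (simp add: sum_distrib_left)
  also have "\<dots> \<le> real n * (\<Sum>i<n. fact n * (real n * G\<^sup>2))"
  proof (intro mult_left_mono sum_mono)
    fix i assume i: "i \<in> {..<n}"
    have "(\<Sum>\<sigma>\<in>?P. (norm (\<Sum>j\<in>{1..i}. v (\<sigma> j)))\<^sup>2) \<le> fact (card {1..n}) * (real (card {1..i}) * G\<^sup>2)"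
      using i by (intro sum_permutes_norm_sum_le v G) auto
    also have "\<dots> \<le> fact n * (real n * G\<^sup>2)"
      using i by (auto intro!: mult_left_mono mult_right_mono)
    finally show "(\<Sum>\<sigma>\<in>?P. (norm (\<Sum>j\<in>{1..i}. v (\<sigma> j)))\<^sup>2) \<le> fact n * (real n * G\<^sup>2)" .
  qed simp
  finally show ?thesis
    by (simp add: expectation_random_permutation field_simps power3_eq_cube power2_eq_square)
qed

text \<open>For each permutation the final distance is at most
  \<open>a + \<beta> * Q \<sigma>\<close>; squaring it separates the initial error from the
  shuffling error, and only the latter needs averaging.\<close>

lemma single_shuffle_expected_gap:
  assumes n: "n > 0" and K: "K > 0" and d: "d \<ge> 1" and L: "L > 0" and \<mu>: "\<mu> > 0"
    and smooth: "\<And>i. i \<in> {1..n} \<Longrightarrow> f i \<in> smooth_class d L"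
    and sc: "strongly_convex d \<mu> (average n f)"
    and min: "is_arg_min (average n f) (\<lambda>x. x \<in> Rd d) z"
    and x: "x \<in> Rd d"
    and G: "\<And>i. i \<in> {1..n} \<Longrightarrow> norm (gradient d (f i) z) \<le> G"
    and l: "l > 0" "real K \<ge> 10 * (L / \<mu>)\<^sup>2 * l"
  shows "measure_pmf.expectation (random_permutation n)
      (\<lambda>\<sigma>. average n f (single_shuffle d n f \<sigma> (\<lambda>_ _. 2 * l / (\<mu> * real n * real K)) x K))
        - average n f z
    \<le> 2 * L * (exp (- l) * norm (x - z))\<^sup>2
      + 50 * G\<^sup>2 / L * (L / \<mu>) ^ 4 * l\<^sup>2 / (real n * (real K)\<^sup>2)"
proof -
  define \<eta> where "\<eta> = 2 * l / (\<mu> * real n * real K)"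
  define \<beta> where "\<beta> = 5 / 2 * \<eta> * L / (real n * \<mu>)"
  define Q where "Q = (\<lambda>\<sigma>. \<Sum>i<n. norm (\<Sum>j=1..i. gradient d (f (\<sigma> j)) z))"
  define X where "X = (\<lambda>\<sigma>. single_shuffle d n f \<sigma> (\<lambda>_ _. \<eta>) x K)"
  define a where "a = exp (- l) * norm (x - z)"
  let ?P = "{\<sigma>. \<sigma> permutes {1..n}}"
  have z: "z \<in> Rd d"
    using min by (simp add: is_arg_min_def)
  have gz: "gradient d (average n f) z = 0"
    using gradient_average_argmin[OF n smooth sc _ L min] \<mu> by simp
  have \<mu>L: "\<mu> \<le> L"
    by (rule strong_convexity_le_smoothness[OF n d smooth sc])
  have \<eta>0: "\<eta> > 0"
    using l \<mu> n K by (simp add: \<eta>_def)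
  \<comment> \<open>The left side is 2 l L^2 / (\<mu> K); the factor 10 in the lower bound on
    \<open>K\<close> is what gives 1/5.\<close>
  have \<eta>2: "real n * \<eta> * L\<^sup>2 \<le> \<mu> / 5"
    using l \<mu> n K by (simp add: \<eta>_def field_simps power2_eq_square)
  have "real n * \<eta> * L * L \<le> 1 / 5 * L"
    using \<eta>2 \<mu>L by (simp add: power2_eq_square mult.assoc)
  then have \<eta>1: "real n * \<eta> * L \<le> 1 / 5"
    using L by simp
  \<comment> \<open>The step size is tuned so that the contraction over all \<open>K\<close> epochs
    is exactly \<open>exp (- l)\<close>.\<close>
  have rate: "\<eta> * real n * \<mu> / 2 * real K = l"
    using \<mu> n K by (simp add: \<eta>_def field_simps)
  have gap: "average n f (X \<sigma>) - average n f z \<le> 2 * L * a\<^sup>2 + 2 * L * \<beta>\<^sup>2 * (Q \<sigma>)\<^sup>2"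
    if \<sigma>: "\<sigma> \<in> ?P" for \<sigma>
  proof -
    have \<sigma>': "\<sigma> permutes {1..n}" using \<sigma> by simp
    have XRd: "X \<sigma> \<in> Rd d"
      unfolding X_def
      by (intro single_shuffle_in_Rd[of n f \<sigma> d L] x smooth) (use permutes_in_image[OF \<sigma>'] in blast)
    have "norm (X \<sigma> - z) \<le> a + \<beta> * Q \<sigma>"
      using single_shuffle_distance[OF \<sigma>' n smooth sc z gz x \<mu> \<mu>L \<eta>0 \<eta>1 \<eta>2, of K] rate
      by (simp add: X_def a_def \<beta>_def Q_def)
    then have "(norm (X \<sigma> - z))\<^sup>2 \<le> (a + \<beta> * Q \<sigma>)\<^sup>2"
      by (intro power_mono) auto
    also have "\<dots> \<le> 2 * a\<^sup>2 + 2 * (\<beta> * Q \<sigma>)\<^sup>2"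
      using sum_squares_bound[of a "\<beta> * Q \<sigma>"] by (simp add: power2_sum)
    finally have "L * (norm (X \<sigma> - z))\<^sup>2 \<le> L * (2 * a\<^sup>2 + 2 * (\<beta> * Q \<sigma>)\<^sup>2)"
      using L by (intro mult_left_mono) auto
    moreover have "average n f (X \<sigma>) - average n f z \<le> L * (norm (X \<sigma> - z))\<^sup>2"
      using \<mu> by (intro average_gap_le[OF n smooth sc _ z gz XRd]) auto
    ultimately show ?thesis
      by (simp add: algebra_simps)
  qed
  have "measure_pmf.expectation (random_permutation n) (\<lambda>\<sigma>. average n f (X \<sigma>)) - average n f z
      = (\<Sum>\<sigma>\<in>?P. average n f (X \<sigma>) - average n f z) / fact n"
    by (simp add: expectation_random_permutation sum_subtractf card_permutations diff_divide_distrib)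
  also have "\<dots> \<le> (\<Sum>\<sigma>\<in>?P. 2 * L * a\<^sup>2 + 2 * L * \<beta>\<^sup>2 * (Q \<sigma>)\<^sup>2) / fact n"
    by (intro divide_right_mono sum_mono gap) auto
  also have "\<dots> = 2 * L * a\<^sup>2 + 2 * L * \<beta>\<^sup>2 * measure_pmf.expectation (random_permutation n) (\<lambda>\<sigma>. (Q \<sigma>)\<^sup>2)"
    by (simp add: expectation_random_permutation sum.distrib card_permutations add_divide_distrib sum_distrib_left)
  also have "\<dots> \<le> 2 * L * a\<^sup>2 + 2 * L * \<beta>\<^sup>2 * ((real n) ^ 3 * G\<^sup>2)"
  proof -
    have "sum (\<lambda>i. gradient d (f i) z) {1..n} = 0"
      using gz n gradient_average[OF n smooth z] by simp
    then have "measure_pmf.expectation (random_permutation n) (\<lambda>\<sigma>. (Q \<sigma>)\<^sup>2) \<le> (real n) ^ 3 * G\<^sup>2"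
      unfolding Q_def by (rule expectation_partial_sums_le[OF _ G])
    then show ?thesis
      using L by (intro add_left_mono mult_left_mono) auto
  qed
  \<comment> \<open>Here \<beta> = 5 l L / (\<mu>^2 n^2 K), and L^3 / \<mu>^4 is rewritten as (L /
    \<mu>)^4 / L.\<close>
  also have "2 * L * \<beta>\<^sup>2 * ((real n) ^ 3 * G\<^sup>2)
      = 50 * G\<^sup>2 / L * (L / \<mu>) ^ 4 * l\<^sup>2 / (real n * (real K)\<^sup>2)"
    using n K L \<mu> by (simp add: \<beta>_def \<eta>_def field_simps eval_nat_numeral)
  finally show ?thesis
    by (simp add: X_def a_def \<eta>_def)
qed

section \<open>Logarithms and the explicit constant\<close>

theorem theorem6:
  fixes L G :: real
  assumes "L > 0" and "G \<ge> 0"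
  shows "\<exists>C. \<forall>(n::nat) (d::nat) (f :: nat \<Rightarrow> finseq \<Rightarrow> real) (\<mu>::real) x\<^sub>0 x_star (K::nat).
    n \<ge> 2 \<longrightarrow> d \<ge> 1 \<longrightarrow> \<mu> > 0 \<longrightarrow> K \<ge> 1 \<longrightarrow> x\<^sub>0 \<in> Rd d \<longrightarrow>
    strongly_convex d \<mu> (average n f) \<longrightarrow>
    (\<forall>i\<in>{1..n}. f i \<in> smooth_class d L) \<longrightarrow>
    is_arg_min (average n f) (\<lambda>x. x \<in> Rd d) x_star \<longrightarrow>
    G = (MAX i\<in>{1..n}. norm (gradient d (f i) x_star)) \<longrightarrow>
    real K \<ge> 10 * (L / \<mu>)\<^sup>2 * ln (sqrt (real n) * real K) \<longrightarrow>
    (\<exists>c. 0 \<le> c \<and> c \<le> C * (L / \<mu>) ^ 4 \<and>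
      measure_pmf.expectation (random_permutation n)
          (\<lambda>\<sigma>. average n f
             (single_shuffle d n f \<sigma>
                (\<lambda>k i. 2 * ln (sqrt (real n) * real K) / (\<mu> * real n * real K)) x\<^sub>0 K))
        - average n f x_star
      \<le> 2 * L * (norm (x\<^sub>0 - x_star))\<^sup>2 / (real n * (real K)\<^sup>2)
        + c * (ln (real n * real K)) ^ 3 / (real n * (real K)\<^sup>2))"
\<comment> \<open>The witness is the 50 of the expected gap times the 2 from
  \<open>l\<^sup>2 \<le> 2 * m ^ 3\<close>; it involves only \<open>L\<close> and
  \<open>G\<close>.\<close>
proof (rule exI[of _ "100 * G\<^sup>2 / L"], intro allI impI)
  fix n d :: nat and f :: "nat \<Rightarrow> finseq \<Rightarrow> real" and \<mu> :: real and x\<^sub>0 x_star K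
  assume n: "n \<ge> 2" and d: "d \<ge> 1" and \<mu>: "\<mu> > 0" and K: "K \<ge> 1" and x0: "x\<^sub>0 \<in> Rd d"
    and sc: "strongly_convex d \<mu> (average n f)"
    and smooth: "\<forall>i\<in>{1..n}. f i \<in> smooth_class d L"
    and min: "is_arg_min (average n f) (\<lambda>x. x \<in> Rd d) x_star"
    and G: "G = (MAX i\<in>{1..n}. norm (gradient d (f i) x_star))"
    and KL: "real K \<ge> 10 * (L / \<mu>)\<^sup>2 * ln (sqrt (real n) * real K)"
  define l where "l = ln (sqrt (real n) * real K)"
  define m where "m = ln (real n * real K)"
  define c where "c = 100 * G\<^sup>2 / L * (L / \<mu>) ^ 4"
  have nK: "real n * real K \<ge> 2"
    using mult_mono[of 2 "real n" 1 "real K"] n K by simp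
  \<comment> \<open>As \<open>n \<ge> 2\<close>, the logarithm \<open>l\<close>, and with it the
    step size, is positive even for \<open>K = 1\<close>.\<close>
  have "sqrt (real n) > 1"
    using n by simp
  then have pos: "sqrt (real n) * real K > 1"
    using less_le_trans[of 1 "sqrt (real n)" "sqrt (real n) * real K"] K by simp
  then have l: "l > 0"
    by (simp add: l_def)
  have "sqrt (real n) \<le> real n"
    using n by (intro real_le_lsqrt) (auto simp: power2_eq_square)
  then have lm: "l \<le> m"
    unfolding l_def m_def using pos K by (intro ln_mono mult_right_mono) auto
  \<comment> \<open>Since then 2m is at least 1, the squared logarithm can be raised to a cube at
    the cost of a factor 2.\<close>
  have "1 / 2 \<le> ln (2 :: real)"
    using ln_one_minus_pos_upper_bound[of "1 / 2"] by (simp add: ln_div)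
  also have "\<dots> \<le> m"
    unfolding m_def using nK by (intro ln_mono) auto
  finally have m: "1 / 2 \<le> m" .
  have "l\<^sup>2 \<le> m\<^sup>2"
    using l lm by (intro power_mono) auto
  also have "\<dots> \<le> 2 * m ^ 3"
    using mult_right_mono[OF m, of "m\<^sup>2"] by (simp add: eval_nat_numeral)
  finally have log: "l\<^sup>2 \<le> 2 * m ^ 3" .
  have c: "c \<ge> 0"
    using assms by (simp add: c_def)
  \<comment> \<open>This identity is why the step size uses the logarithm of sqrt(n) K: the initial
    error decays exactly at the target rate.\<close>
  have exp: "(exp (- l))\<^sup>2 = 1 / (real n * (real K)\<^sup>2)"
    using pos by (simp add: l_def exp_minus power_mult_distrib inverse_eq_divide power_one_over)
  have "measure_pmf.expectation (random_permutation n)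
      (\<lambda>\<sigma>. average n f (single_shuffle d n f \<sigma> (\<lambda>k i. 2 * l / (\<mu> * real n * real K)) x\<^sub>0 K))
        - average n f x_star
    \<le> 2 * L * (exp (- l) * norm (x\<^sub>0 - x_star))\<^sup>2
      + 50 * G\<^sup>2 / L * (L / \<mu>) ^ 4 * l\<^sup>2 / (real n * (real K)\<^sup>2)"
  proof (rule single_shuffle_expected_gap[OF _ _ d \<open>L > 0\<close> \<mu> _ sc min x0])
    show "norm (gradient d (f i) x_star) \<le> G" if "i \<in> {1..n}" for i
      unfolding G using that by (intro Max_ge) auto
  qed (use n K smooth l KL in \<open>auto simp: l_def\<close>)
  also have "50 * G\<^sup>2 / L * (L / \<mu>) ^ 4 * l\<^sup>2 \<le> c * m ^ 3"
    using mult_left_mono[OF log c] by (simp add: c_def)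
  finally have "measure_pmf.expectation (random_permutation n)
      (\<lambda>\<sigma>. average n f (single_shuffle d n f \<sigma> (\<lambda>k i. 2 * l / (\<mu> * real n * real K)) x\<^sub>0 K))
        - average n f x_star
    \<le> 2 * L * (norm (x\<^sub>0 - x_star))\<^sup>2 / (real n * (real K)\<^sup>2) + c * m ^ 3 / (real n * (real K)\<^sup>2)"
    by (simp add: power_mult_distrib exp divide_right_mono)
  then show "\<exists>c. 0 \<le> c \<and> c \<le> 100 * G\<^sup>2 / L * (L / \<mu>) ^ 4 \<and>
      measure_pmf.expectation (random_permutation n)
          (\<lambda>\<sigma>. average n f
             (single_shuffle d n f \<sigma>
                (\<lambda>k i. 2 * ln (sqrt (real n) * real K) / (\<mu> * real n * real K)) x\<^sub>0 K))
        - average n f x_star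
      \<le> 2 * L * (norm (x\<^sub>0 - x_star))\<^sup>2 / (real n * (real K)\<^sup>2)
        + c * (ln (real n * real K)) ^ 3 / (real n * (real K)\<^sup>2)"
    using c by (intro exI[of _ c]) (simp add: c_def l_def m_def)
qed

end
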